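(* Let $A,B\in\mathbb{R}$ with $-1\le B<A\le 1$, and let $f\in\mathcal{C}(A,B)$, $f(z)=z+\sum_{n\ge 2}a_nz^n$. Then the first two logarithmic coefficients of $f$ satisfy the following sharp inequalities: $$|\gamma_2|-|\gamma_1|\le\frac{A-B}{12},$$ $$|\gamma_2|-|\gamma_1|\ge\begin{cases}-\dfrac{A-B}{4}\Big(1-\dfrac{|A-5B|}{12}\Big), & |A-5B|\le2,\\[2mm] -\dfrac{A-B}{2}\,\dfrac{1}{\sqrt{|A-5B|+4}}, & |A-5B|\ge5,\\[2mm] -\dfrac{A-B}{12}\Big(1+\dfrac{9}{|A-5B|+4}\Big), & \text{otherwise}.\end{cases}$$
   Context: Let $\mathbb{D}=\{z\in\mathbb{C}:|z|<1\}$ and let $\mathcal{A}$ be the class of holomorphic functions $f$ on $\mathbb{D}$ with $f(0)=0$, $f'(0)=1$, i.e. $f(z)=z+\sum_{n=2}^\infty a_nz^n$. For holomorphic $g,h$ on $\mathbb{D}$, $g\prec h$ (subordination) means there is a holomorphic $\omega:\mathbb{D}\to\mathbb{D}$ with $\omega(0)=0$ and $g=h\circ\omega$. For $-1\le B<A\le1$, the Janowski convex class is $$\mathcal{C}(A,B)=\Big\{f\in\mathcal{A}: 1+\frac{zf''(z)}{f'(z)}\prec\frac{1+Az}{1+Bz}\Big\}.$$ Functions in $\mathcal{C}(A,B)$ are univalent. The logarithmic coefficients $\gamma_n$ of $f$ are defined by $\log\frac{f(z)}{z}=2\sum_{n=1}^\infty\gamma_nz^n$ near the origin; in particular $\gamma_1=\frac12a_2$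 and $\gamma_2=\frac12\big(a_3-\frac12a_2^2\big)$. "Sharp" means that for each admissible $(A,B)$ (falling in the indicated case) there is a function $f\in\mathcal{C}(A,B)$ for which equality holds in the corresponding inequality. *)

theory Defs
  imports "HOL-Complex_Analysis.Complex_Analysis"
begin

abbreviation unit_disc :: "complex set" where
  "unit_disc \<equiv> ball 0 1"

definition class_A :: "(complex \<Rightarrow> complex) set" where
  "class_A = {f. f holomorphic_on unit_disc \<and> f 0 = 0 \<and> deriv f 0 = 1}"

definition subordinate :: "(complex \<Rightarrow> complex) \<Rightarrow> (complex \<Rightarrow> complex) \<Rightarrow> bool"
    (infix "\<prec>\<^sub>D" 50) where
  "g \<prec>\<^sub>D h \<longleftrightarrow> g holomorphic_on unit_disc \<and> h holomorphic_on unit_disc \<and>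
     (\<exists>\<omega>. \<omega> holomorphic_on unit_disc \<and> \<omega> ` unit_disc \<subseteq> unit_disc \<and> \<omega> 0 = 0 \<and>
          (\<forall>z\<in>unit_disc. g z = h (\<omega> z)))"

(* The condition deriv f z \<noteq> 0 makes explicit that the quotient z f''(z) / f'(z) is defined
   on the whole disc; in HOL, division by zero would return 0. *)
definition janowski_convex :: "real \<Rightarrow> real \<Rightarrow> (complex \<Rightarrow> complex) set" where
  "janowski_convex A B = {f \<in> class_A.
     (\<forall>z\<in>unit_disc. deriv f z \<noteq> 0) \<and>
     (\<lambda>z. 1 + z * deriv (deriv f) z / deriv f z)
       \<prec>\<^sub>D (\<lambda>z. (1 + of_real A * z) / (1 + of_real B * z))}"

(* f(z)/z with the removable singularity at 0 filled in (f'(0) = 1); near 0 the values are close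
   to 1, so the principal branch Ln is the branch of the logarithm vanishing at z = 0. *)
definition log_quot :: "(complex \<Rightarrow> complex) \<Rightarrow> complex \<Rightarrow> complex" where
  "log_quot f z = Ln (if z = 0 then 1 else f z / z)"

definition log_coeff :: "(complex \<Rightarrow> complex) \<Rightarrow> nat \<Rightarrow> complex" where
  "log_coeff f n = fps_nth (fps_expansion (log_quot f) 0) n / 2"

lemma log_quot_analytic:
  assumes "f \<in> class_A"
  shows "log_quot f analytic_on {0}"
proof -
  define g where "g = (\<lambda>z. if z = 0 then 1 else f z / z)"
  have "(\<lambda>z. if z = 0 then deriv f 0 else (f z - f 0) / (z - 0)) holomorphic_on unit_disc"
    using assms by (intro pole_lemma_open) (auto simp: class_A_def)
  moreover have "(\<lambda>z. if z = 0 then deriv f 0 else (f z - f 0) / (z - 0)) = g"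
    using assms by (auto simp: g_def class_A_def fun_eq_iff)
  ultimately have "g holomorphic_on unit_disc"
    by simp
  then have "g analytic_on {0}"
    using analytic_at open_ball centre_in_ball zero_less_one by blast
  then have "(\<lambda>z. Ln (g z)) analytic_on {0}"
    by (intro analytic_intros) (auto simp: g_def)
  then show ?thesis
    unfolding g_def log_quot_def .
qed

lemma log_coeff_expansion:
  assumes "f \<in> class_A"
  shows "\<forall>\<^sub>F z in at 0. (\<lambda>n. 2 * log_coeff f (Suc n) * z ^ Suc n) sums Ln (f z / z)"
proof -
  define F where "F = fps_expansion (log_quot f) 0"
  have exp: "log_quot f has_fps_expansion F"
    unfolding F_def using log_quot_analytic[OF assms] analytic_at_imp_has_fps_expansion_0 by blast
  have F0: "fps_nth F 0 = 0"
    using has_fps_expansion_imp_0_eq_fps_nth_0[OF exp] by (simp add: log_quot_def)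
  have "\<forall>\<^sub>F z in nhds 0. z \<in> eball 0 (fps_conv_radius F)"
    using exp by (intro eventually_nhds_in_open) (auto simp: has_fps_expansion_def zero_ereal_def)
  moreover have "\<forall>\<^sub>F z in nhds 0. eval_fps F z = log_quot f z"
    using exp by (simp add: has_fps_expansion_def)
  ultimately have "\<forall>\<^sub>F z in nhds 0. (\<lambda>n. fps_nth F n * z ^ n) sums log_quot f z"
  proof eventually_elim
    case (elim z)
    then have "norm z < fps_conv_radius F" by (simp add: in_eball_iff)
    from sums_eval_fps[OF this] elim show ?case by simp
  qed
  then have "\<forall>\<^sub>F z in at 0. (\<lambda>n. fps_nth F n * z ^ n) sums log_quot f z"
    by (simp add: eventually_at_filter eventually_mono)
  moreover have "\<forall>\<^sub>F z in at (0::complex). z \<noteq> 0"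
    by (simp add: eventually_at_filter)
  ultimately show ?thesis
  proof eventually_elim
    case (elim z)
    then have "(\<lambda>n. fps_nth F (Suc n) * z ^ Suc n) sums log_quot f z"
      using F0 by (subst sums_Suc_iff) simp
    with elim(2) show ?case
      by (simp add: log_coeff_def F_def log_quot_def)
  qed
qed

end

theory Submission
  imports Defs
begin

text \<open>
  Write the subordinating function as \<open>\<omega> z = z * \<phi> z\<close>. By the Schwarz lemma \<open>\<phi>\<close> is an arbitrary
  holomorphic function from the disc into the closed disc, and the class condition becomes the
  differential equation \<open>z f'' (1 + B z \<phi>) = (A - B) z \<phi> f'\<close>, which is solvable for every such
  \<open>\<phi>\<close> (lemma \<open>janowski_convex_iff\<close> and lemma \<open>janowski_ode_solvable\<close>). Comparing Taylor coefficients,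
  with \<open>c = \<phi> 0\<close>, \<open>d = \<phi>' 0\<close> and \<open>\<mu> = (A - 5 B) / 4\<close>,
  \<open>\<gamma>\<^sub>1 = (A - B) / 4 * c\<close> and \<open>\<gamma>\<^sub>2 = (A - B) / 12 * (d + \<mu> c\<^sup>2)\<close>,
  so the problem is to find the extreme values of \<open>\<bar>d + \<mu> c\<^sup>2\<bar> - 3 \<bar>c\<bar>\<close>.

  The only constraint on \<open>(c, d)\<close> is the Schwarz--Pick inequality \<open>\<bar>d\<bar> \<le> 1 - \<bar>c\<bar>\<^sup>2\<close>. With
  \<open>x = \<bar>c\<bar>\<close> and \<open>q = \<bar>\<mu>\<bar> \<le> 3/2\<close>, the quantity is therefore at most
  \<open>1 - x\<^sup>2 + q x\<^sup>2 - 3 x \<le> 1\<close>, and at least \<open>max 0 ((1 + q) x\<^sup>2 - 1) - 3 x\<close>. The latter is decreasing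
  up to the kink \<open>x = 1 / sqrt (1 + q)\<close> and a convex parabola with vertex \<open>3 / (2 (1 + q))\<close> after it;
  the three cases of the theorem say that the minimum on \<open>[0, 1]\<close> is at the end point 1, at the
  vertex, or at the kink. For sharpness, the Moebius choice
  \<open>\<phi> z = (x - \<epsilon> z) / (1 - \<epsilon> x z)\<close> with \<open>\<epsilon>\<close> the sign of \<open>\<mu>\<close> makes \<open>d = - \<epsilon> (1 - x\<^sup>2)\<close> point
  exactly against \<open>\<mu> c\<^sup>2\<close>; its quantity is \<open>\<bar>(1 + q) x\<^sup>2 - 1\<bar> - 3 x\<close>, which is 1 at \<open>x = 0\<close> and
  equals the lower estimate at the minimizing \<open>x\<close>.
\<close>

section \<open>The Schwarz--Pick inequality at the origin\<close>

text \<open>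
  If the values stay in the open disc, composing with the disc automorphism that sends \<open>\<phi> 0\<close> to 0
  reduces the claim to the derivative bound of the Schwarz lemma. If a value lies on the unit circle,
  the maximum principle makes \<open>\<phi>\<close> constant.
\<close>

lemma Schwarz_Pick_origin:
  assumes hol: "\<phi> holomorphic_on ball 0 1"
    and le: "\<And>z. norm z < 1 \<Longrightarrow> norm (\<phi> z) \<le> 1"
  shows "norm (deriv \<phi> 0) \<le> 1 - (norm (\<phi> 0))\<^sup>2"
proof (cases "\<exists>w. norm w < 1 \<and> norm (\<phi> w) = 1")
  case True
  then obtain w where w: "norm w < 1" "norm (\<phi> w) = 1" by blast
  have "\<phi> constant_on ball 0 1"
    by (rule maximum_modulus_principle[OF hol, where U = "ball 0 1" and \<xi> = w])
       (use w le in auto)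
  then obtain k where k: "\<And>z. norm z < 1 \<Longrightarrow> \<phi> z = k"
    by (auto simp: constant_on_def)
  have "deriv \<phi> 0 = deriv (\<lambda>_. k) 0"
    by (rule complex_derivative_transform_within_open[OF hol _ open_ball]) (auto intro: k)
  moreover have "norm (\<phi> 0) = 1"
    using k[of 0] k[of w] w by simp
  ultimately show ?thesis by simp
next
  case False
  with le have less: "norm (\<phi> z) < 1" if "norm z < 1" for z
    using that by (meson order_le_less)
  define c where "c = \<phi> 0"
  have c: "norm c < 1" using less[of 0] by (simp add: c_def)
  define g where "g = Moebius_function 0 c \<circ> \<phi>"
  have img: "\<phi> ` ball 0 1 \<subseteq> ball 0 1" using less by auto
  have "norm (deriv g 0) \<le> 1"
  proof (rule Schwarz_Lemma(2)[where \<xi> = 0])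
    show "g holomorphic_on ball 0 1"
      unfolding g_def using Moebius_function_holomorphic[OF c]
      by (rule holomorphic_on_compose_gen[OF hol _ img])
    show "g 0 = 0" by (simp add: g_def c_def Moebius_function_def)
    show "norm (g z) < 1" if "norm z < 1" for z
      using Moebius_function_norm_lt_1[OF c less[OF that]] by (simp add: g_def)
  qed auto
  moreover have "deriv g 0 = deriv \<phi> 0 / (1 - cnj c * c)"
  proof (rule DERIV_imp_deriv)
    have d: "(\<phi> has_field_derivative deriv \<phi> 0) (at 0)"
      using hol by (rule holomorphic_derivI) auto
    have nz: "1 - cnj c * c \<noteq> 0"
    proof
      assume "1 - cnj c * c = 0"
      then have "norm (cnj c * c) = 1" by simp
      then have "(norm c)\<^sup>2 = 1" by (simp add: norm_mult power2_eq_square)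
      with c norm_ge_zero[of c] show False by (auto simp: power2_eq_1_iff simp del: norm_ge_zero)
    qed
    have geq: "g = (\<lambda>z. (\<phi> z - c) / (1 - cnj c * \<phi> z))"
      by (simp add: g_def Moebius_function_def fun_eq_iff)
    show "(g has_field_derivative deriv \<phi> 0 / (1 - cnj c * c)) (at 0)"
      unfolding geq
      by (rule derivative_eq_intros d refl | use nz in \<open>simp add: c_def\<close>)+
  qed
  moreover have "norm (1 - cnj c * c) = 1 - (norm c)\<^sup>2"
  proof -
    have "1 - cnj c * c = of_real (1 - (norm c)\<^sup>2)"
      unfolding of_real_diff complex_norm_square by (simp add: mult.commute)
    moreover have "(norm c)\<^sup>2 \<le> 1" using c by (simp add: power_le_one)
    ultimately show ?thesis by (metis abs_of_nonneg diff_ge_0_iff_ge norm_of_real)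
  qed
  moreover have "(norm c)\<^sup>2 < 1" using c by (simp add: power_less_one_iff abs_square_less_1)
  ultimately have "norm (deriv \<phi> 0) / (1 - (norm c)\<^sup>2) \<le> 1" "1 - (norm c)\<^sup>2 > 0"
    by (simp_all add: norm_divide)
  then show ?thesis by (simp add: c_def pos_divide_le_eq)
qed

section \<open>The differential equation of the Janowski class\<close>

text \<open>
  The Schwarz lemma absorbs both conditions on \<open>\<omega>\<close>: self-maps of the disc fixing 0 are the functions
  \<open>z * \<phi> z\<close> with \<open>\<bar>\<phi>\<bar> \<le> 1\<close>.
\<close>

lemma schwarz_function_factor:
  assumes "\<omega> holomorphic_on unit_disc" "\<omega> ` unit_disc \<subseteq> unit_disc" "\<omega> 0 = 0"
  obtains \<phi> where "\<phi> holomorphic_on unit_disc" "\<And>z. norm z < 1 \<Longrightarrow> norm (\<phi> z) \<le> 1"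
    "\<And>z. norm z < 1 \<Longrightarrow> \<omega> z = z * \<phi> z"
proof -
  obtain \<phi> where \<phi>: "\<phi> holomorphic_on unit_disc" "\<And>z. norm z < 1 \<Longrightarrow> \<omega> z = z * \<phi> z"
      "deriv \<omega> 0 = \<phi> 0"
    using Schwarz3[OF assms(1) assms(3)] by metis
  have lt: "norm (\<omega> z) < 1" if "norm z < 1" for z
    using assms(2) that by (auto simp: image_subset_iff)
  have "norm (\<phi> z) \<le> 1" if z: "norm z < 1" for z
  proof (cases "z = 0")
    case True
    have "norm (deriv \<omega> 0) \<le> 1"
      by (rule Schwarz_Lemma(2)[OF assms(1,3) lt z])
    with True \<phi>(3) show ?thesis by simp
  next
    case False
    have "norm (\<omega> z) \<le> norm z"
      by (rule Schwarz_Lemma(1)[OF assms(1,3) lt z])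
    with False \<phi>(2)[OF z] show ?thesis by (simp add: norm_mult)
  qed
  with \<phi> show thesis by (intro that) auto
qed

lemma norm_mult_less_1:
  fixes z w :: complex
  assumes "norm z < 1" "norm w \<le> 1"
  shows "norm (z * w) < 1"
  using mult_left_le[OF assms(2) norm_ge_zero[of z]] assms(1) by (simp add: norm_mult)

lemma one_plus_of_real_mult_nonzero:
  fixes w :: complex
  assumes "\<bar>B\<bar> \<le> 1" "norm w < 1"
  shows "1 + of_real B * w \<noteq> 0"
proof
  assume "1 + of_real B * w = 0"
  then have "norm (of_real B * w) = 1"
    by (metis add_eq_0_iff norm_minus_cancel norm_one)
  moreover have "norm (w * of_real B) < 1"
    using assms by (intro norm_mult_less_1) auto
  ultimately show False by (simp add: mult.commute)
qed

lemma janowski_convex_iff: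
  assumes B: "\<bar>B\<bar> \<le> 1"
  shows "f \<in> janowski_convex A B \<longleftrightarrow>
    f \<in> class_A \<and> (\<forall>z\<in>unit_disc. deriv f z \<noteq> 0) \<and>
    (\<exists>\<phi>. \<phi> holomorphic_on unit_disc \<and> (\<forall>z\<in>unit_disc. norm (\<phi> z) \<le> 1) \<and>
      (\<forall>z\<in>unit_disc. z * deriv (deriv f) z * (1 + of_real B * (z * \<phi> z)) =
                      of_real (A - B) * (z * \<phi> z) * deriv f z))"
    (is "_ \<longleftrightarrow> ?A \<and> ?N \<and> (\<exists>\<phi>. ?H \<phi> \<and> ?le \<phi> \<and> ?ode \<phi>)")
proof -
  let ?g = "\<lambda>z. 1 + z * deriv (deriv f) z / deriv f z"
  let ?h = "\<lambda>z. (1 + of_real A * z) / (1 + of_real B * z) :: complex"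
  have eq: "?g z = ?h w \<longleftrightarrow>
      z * deriv (deriv f) z * (1 + of_real B * w) = of_real (A - B) * w * deriv f z"
    if "deriv f z \<noteq> 0" "norm w < 1" for z w
    using that one_plus_of_real_mult_nonzero[OF B that(2)]
    by (simp add: field_simps)
  have "?g \<prec>\<^sub>D ?h \<longleftrightarrow> (\<exists>\<phi>. ?H \<phi> \<and> ?le \<phi> \<and> ?ode \<phi>)" if A: ?A and N: ?N
  proof
    assume "?g \<prec>\<^sub>D ?h"
    then obtain \<omega> where \<omega>: "\<omega> holomorphic_on unit_disc" "\<omega> ` unit_disc \<subseteq> unit_disc" "\<omega> 0 = 0"
        "\<And>z. z \<in> unit_disc \<Longrightarrow> ?g z = ?h (\<omega> z)"
      unfolding subordinate_def by blast
    obtain \<phi> where \<phi>: "\<phi> holomorphic_on unit_disc" "\<And>z. norm z < 1 \<Longrightarrow> norm (\<phi> z) \<le> 1"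
        "\<And>z. norm z < 1 \<Longrightarrow> \<omega> z = z * \<phi> z"
      using schwarz_function_factor[OF \<omega>(1-3)] by metis
    have "?ode \<phi>"
    proof
      fix z :: complex assume z: "z \<in> unit_disc"
      then have "norm (z * \<phi> z) < 1" using \<phi>(2) by (intro norm_mult_less_1) auto
      with eq[of z "z * \<phi> z"] N z \<omega>(4)[OF z] \<phi>(3)[of z]
      show "z * deriv (deriv f) z * (1 + of_real B * (z * \<phi> z)) =
          of_real (A - B) * (z * \<phi> z) * deriv f z" by auto
    qed
    with \<phi> show "\<exists>\<phi>. ?H \<phi> \<and> ?le \<phi> \<and> ?ode \<phi>" by (intro exI[of _ \<phi>]) auto
  next
    assume "\<exists>\<phi>. ?H \<phi> \<and> ?le \<phi> \<and> ?ode \<phi>"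
    then obtain \<phi> where \<phi>: "?H \<phi>" "?le \<phi>" "?ode \<phi>" by blast
    have lt: "norm (z * \<phi> z) < 1" if "z \<in> unit_disc" for z
      using that \<phi>(2) by (intro norm_mult_less_1) auto
    have f: "f holomorphic_on unit_disc" using A by (simp add: class_A_def)
    have "?g holomorphic_on unit_disc"
      using N by (intro holomorphic_intros f open_ball) auto
    moreover have "?h holomorphic_on unit_disc"
      using one_plus_of_real_mult_nonzero[OF B] by (intro holomorphic_intros) auto
    moreover have "(\<lambda>z. z * \<phi> z) holomorphic_on unit_disc"
      by (intro holomorphic_intros \<phi>(1))
    moreover have "?g z = ?h (z * \<phi> z)" if z: "z \<in> unit_disc" for z
      using eq[OF _ lt[OF z]] N \<phi>(3) z by blast
    ultimately show "?g \<prec>\<^sub>D ?h"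
      unfolding subordinate_def using lt
      by (intro conjI exI[of _ "\<lambda>z. z * \<phi> z"]) auto
  qed
  then show ?thesis unfolding janowski_convex_def by auto
qed

text \<open>
  The equation is first-order linear in \<open>f'\<close>, so two successive primitives on the disc solve it, and
  writing \<open>f' = exp h\<close> keeps the derivative away from 0.
\<close>

lemma janowski_ode_solvable:
  assumes B: "\<bar>B\<bar> \<le> 1"
    and hol: "\<phi> holomorphic_on unit_disc" and le: "\<And>z. norm z < 1 \<Longrightarrow> norm (\<phi> z) \<le> 1"
  obtains f where "f \<in> janowski_convex A B"
    "\<And>z. z \<in> unit_disc \<Longrightarrow> z * deriv (deriv f) z * (1 + of_real B * (z * \<phi> z)) =
                      of_real (A - B) * (z * \<phi> z) * deriv f z"
proof -
  have nz: "1 + of_real B * (z * \<phi> z) \<noteq> 0" if "norm z < 1" for z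
    using norm_mult_less_1[OF that le[OF that]] by (rule one_plus_of_real_mult_nonzero[OF B])
  define p where "p z = of_real (A - B) * \<phi> z / (1 + of_real B * (z * \<phi> z))" for z
  have "p holomorphic_on unit_disc"
    unfolding p_def using nz by (intro holomorphic_intros hol) auto
  then obtain h0 where h0: "\<And>z. z \<in> unit_disc \<Longrightarrow> (h0 has_field_derivative p z) (at z within unit_disc)"
    using holomorphic_convex_primitive'[OF convex_ball open_ball] by metis
  define h where "h z = h0 z - h0 0" for z
  have h: "(h has_field_derivative p z) (at z)" if "z \<in> unit_disc" for z
    unfolding h_def using h0[OF that] that
    by (auto intro!: derivative_eq_intros simp: at_within_open[OF that open_ball])
  have eh: "((\<lambda>z. exp (h z)) has_field_derivative exp (h z) * p z) (at z)" if "z \<in> unit_disc" for z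
    using h[OF that] by (auto intro!: derivative_eq_intros)
  have exp_hol: "(\<lambda>z. exp (h z)) holomorphic_on unit_disc"
    using eh unfolding holomorphic_on_open[OF open_ball] by blast
  obtain f0 where f0: "\<And>z. z \<in> unit_disc \<Longrightarrow>
      (f0 has_field_derivative exp (h z)) (at z within unit_disc)"
    using holomorphic_convex_primitive'[OF convex_ball open_ball exp_hol] by metis
  define f where "f z = f0 z - f0 0" for z
  have f: "(f has_field_derivative exp (h z)) (at z)" if "z \<in> unit_disc" for z
    unfolding f_def using f0[OF that] that
    by (auto intro!: derivative_eq_intros simp: at_within_open[OF that open_ball])
  have f_hol: "f holomorphic_on unit_disc" using f unfolding holomorphic_on_open[OF open_ball] by blast
  have df: "deriv f z = exp (h z)" if "z \<in> unit_disc" for z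
    using f[OF that] by (rule DERIV_imp_deriv)
  have ddf: "deriv (deriv f) z = exp (h z) * p z" if "z \<in> unit_disc" for z
  proof -
    have "deriv (deriv f) z = deriv (\<lambda>z. exp (h z)) z"
      by (rule complex_derivative_transform_within_open[where s = unit_disc])
         (use that df f_hol exp_hol in \<open>auto intro!: holomorphic_intros\<close>)
    also have "\<dots> = exp (h z) * p z" using eh[OF that] by (rule DERIV_imp_deriv)
    finally show ?thesis .
  qed
  have ode: "z * deriv (deriv f) z * (1 + of_real B * (z * \<phi> z)) =
      of_real (A - B) * (z * \<phi> z) * deriv f z" if "z \<in> unit_disc" for z
    using that nz[of z] by (simp add: df ddf p_def)
  have "f \<in> class_A"
    using f_hol df[of 0] by (simp add: class_A_def f_def h_def)
  then have "f \<in> janowski_convex A B"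
    unfolding janowski_convex_iff[OF B] using df hol le ode
    by (intro conjI exI[of _ \<phi>] ballI ode) simp_all
  then show thesis using ode by (rule that)
qed

section \<open>The first two logarithmic coefficients\<close>

text \<open>
  Near 0 we have \<open>f z = z * exp (log_quot f z)\<close>. Differentiating the power series \<open>G\<close> of the
  exponential, \<open>G' = G * L'\<close>, gives a recursion for the coefficients of \<open>f\<close> in terms of those of \<open>L\<close>.
\<close>

lemma log_coeff_eq:
  assumes f: "f \<in> class_A"
  defines "F \<equiv> fps_expansion f 0"
  shows "log_coeff f 1 = fps_nth F 2 / 2"
    and "log_coeff f 2 = (fps_nth F 3 - (fps_nth F 2)\<^sup>2 / 2) / 2"
proof -
  define L where "L = fps_expansion (log_quot f) 0"
  have L: "log_quot f has_fps_expansion L"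
    unfolding L_def using log_quot_analytic[OF f] analytic_at_imp_has_fps_expansion_0 by blast
  have L0: "fps_nth L 0 = 0"
    using has_fps_expansion_imp_0_eq_fps_nth_0[OF L] by (simp add: log_quot_def)
  define G where "G = fps_exp 1 oo L"
  have "(exp \<circ> log_quot f) has_fps_expansion G"
    unfolding G_def using L L0 has_fps_expansion_exp1 by (intro has_fps_expansion_compose) auto
  then have "(\<lambda>z. z * exp (log_quot f z)) has_fps_expansion fps_X * G"
    by (intro fps_expansion_intros) (simp add: o_def)
  moreover have "\<forall>\<^sub>F z in nhds 0. z * exp (log_quot f z) = f z"
  proof -
    have "f holomorphic_on unit_disc" "f 0 = 0" "deriv f 0 = 1"
      using f by (auto simp: class_A_def)
    then have "(f has_field_derivative 1) (at 0)"
      using holomorphic_derivI[of f unit_disc 0] by simp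
    then have "((\<lambda>z. f z / z) \<longlongrightarrow> 1) (at 0)"
      using \<open>f 0 = 0\<close> by (simp add: has_field_derivative_iff)
    then have "\<forall>\<^sub>F z in at 0. f z / z \<noteq> 0"
      by (rule tendsto_imp_eventually_ne) simp
    then have "\<forall>\<^sub>F z in at 0. z * exp (log_quot f z) = f z"
    proof (rule eventually_mono)
      fix z assume "f z / z \<noteq> 0"
      then show "z * exp (log_quot f z) = f z"
        by (auto simp: log_quot_def)
    qed
    then show ?thesis
      using \<open>f 0 = 0\<close> by (simp add: eventually_nhds_conv_at)
  qed
  ultimately have "f has_fps_expansion fps_X * G"
    by (simp cong: has_fps_expansion_cong)
  then have F: "F = fps_X * G"
    unfolding F_def by (rule fps_expansion_eqI)
  have G0: "fps_nth G 0 = 1" by (simp add: G_def)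
  have G': "fps_deriv G = G * fps_deriv L"
    unfolding G_def using L0 by (simp add: fps_compose_deriv)
  have G1: "fps_nth G 1 = fps_nth L 1"
    using arg_cong[OF G', of "\<lambda>S. fps_nth S 0"] G0 by simp
  have G2: "2 * fps_nth G 2 = 2 * fps_nth L 2 + (fps_nth L 1)\<^sup>2"
    using arg_cong[OF G', of "\<lambda>S. fps_nth S 1"] G0 G1
    by (simp add: fps_mult_nth power2_eq_square numeral_2_eq_2)
  show "log_coeff f 1 = fps_nth F 2 / 2"
    using G1 by (simp add: log_coeff_def F L_def)
  show "log_coeff f 2 = (fps_nth F 3 - (fps_nth F 2)\<^sup>2 / 2) / 2"
    using G1 G2 by (simp add: log_coeff_def F L_def[symmetric] field_simps)
qed

lemma janowski_ode_coeffs: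
  assumes f: "f \<in> class_A" and hol: "\<phi> holomorphic_on unit_disc"
    and ode: "\<And>z. z \<in> unit_disc \<Longrightarrow> z * deriv (deriv f) z * (1 + of_real B * (z * \<phi> z)) =
                      of_real (A - B) * (z * \<phi> z) * deriv f z"
  defines "F \<equiv> fps_expansion f 0"
  shows "2 * fps_nth F 2 = of_real (A - B) * \<phi> 0"
    and "6 * fps_nth F 3 = of_real (A - B) * (deriv \<phi> 0 + of_real (A - 2 * B) * (\<phi> 0)\<^sup>2)"
proof -
  define P where "P = fps_expansion \<phi> 0"
  have F: "f has_fps_expansion F"
    unfolding F_def using f by (intro has_fps_expansion_fps_expansion[of unit_disc]) (auto simp: class_A_def)
  have P: "\<phi> has_fps_expansion P"
    unfolding P_def using hol by (intro has_fps_expansion_fps_expansion[of unit_disc]) auto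
  have P0: "fps_nth P 0 = \<phi> 0" and P1: "fps_nth P 1 = deriv \<phi> 0"
    by (simp_all add: P_def fps_expansion_def)
  have F1: "fps_nth F 1 = 1"
    using f by (simp add: F_def fps_expansion_def class_A_def)
  have lhs: "(\<lambda>z. z * deriv (deriv f) z * (1 + of_real B * (z * \<phi> z))) has_fps_expansion
      fps_X * fps_deriv (fps_deriv F) * (1 + fps_const (of_real B) * (fps_X * P))"
    by (intro fps_expansion_intros F P)
  have rhs: "(\<lambda>z. of_real (A - B) * (z * \<phi> z) * deriv f z) has_fps_expansion
      fps_const (of_real (A - B)) * (fps_X * P) * fps_deriv F"
    by (intro fps_expansion_intros F P)
  have ev: "\<forall>\<^sub>F z in nhds 0. z * deriv (deriv f) z * (1 + of_real B * (z * \<phi> z)) =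
      of_real (A - B) * (z * \<phi> z) * deriv f z"
    by (rule eventually_mono[OF eventually_nhds_in_open[of unit_disc 0]]) (auto simp: ode)
  have "fps_X * fps_deriv (fps_deriv F) * (1 + fps_const (of_real B) * (fps_X * P)) =
      fps_const (of_real (A - B)) * (fps_X * P) * fps_deriv F"
    using lhs[unfolded has_fps_expansion_cong[OF ev refl]] rhs by (rule fps_expansion_unique_complex)
  then have "fps_X * (fps_deriv (fps_deriv F) * (1 + fps_const (of_real B) * (fps_X * P))) =
      fps_X * (fps_const (of_real (A - B)) * (P * fps_deriv F))"
    by (simp only: mult_ac)
  then have E: "fps_deriv (fps_deriv F) * (1 + fps_const (of_real B) * (fps_X * P)) =
      fps_const (of_real (A - B)) * (P * fps_deriv F)"
    by simp
  show F2: "2 * fps_nth F 2 = of_real (A - B) * \<phi> 0"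
    using arg_cong[OF E, of "\<lambda>S. fps_nth S 0"] P0 F1 by (simp add: numeral_2_eq_2)
  have "6 * fps_nth F 3 + 2 * fps_nth F 2 * of_real B * \<phi> 0 =
      of_real (A - B) * (\<phi> 0 * (2 * fps_nth F 2) + deriv \<phi> 0)"
    using arg_cong[OF E, of "\<lambda>S. fps_nth S 1"] P0 P1 F1
    by (simp add: fps_mult_nth numeral_2_eq_2 numeral_3_eq_3 algebra_simps)
  then show "6 * fps_nth F 3 = of_real (A - B) * (deriv \<phi> 0 + of_real (A - 2 * B) * (\<phi> 0)\<^sup>2)"
    unfolding F2 by (simp add: algebra_simps power2_eq_square)
qed

text \<open>
  Passing from \<open>f\<close> to the logarithm subtracts half of the squared second coefficient, which turns the
  factor \<open>A - 2 B\<close> of \<open>(\<phi> 0)\<^sup>2\<close> into \<open>A - 2 B - 3/4 (A - B) = (A - 5 B) / 4\<close>.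
\<close>

lemma norm_log_coeff_diff:
  assumes "B < A" and f: "f \<in> class_A" and hol: "\<phi> holomorphic_on unit_disc"
    and ode: "\<And>z. z \<in> unit_disc \<Longrightarrow> z * deriv (deriv f) z * (1 + of_real B * (z * \<phi> z)) =
                      of_real (A - B) * (z * \<phi> z) * deriv f z"
  shows "norm (log_coeff f 2) - norm (log_coeff f 1) =
    (A - B) / 12 * (norm (deriv \<phi> 0 + of_real ((A - 5 * B) / 4) * (\<phi> 0)\<^sup>2) - 3 * norm (\<phi> 0))"
proof -
  note F = janowski_ode_coeffs[OF f hol ode]
  define a b where "a = fps_nth (fps_expansion f 0) 2" and "b = fps_nth (fps_expansion f 0) 3"
  have a: "a = of_real (A - B) * \<phi> 0 / 2"
    using F(1) by (simp add: a_def field_simps)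
  have b: "b = of_real (A - B) * (deriv \<phi> 0 + of_real (A - 2 * B) * (\<phi> 0)\<^sup>2) / 6"
    using F(2) by (simp add: b_def field_simps)
  have "log_coeff f 1 = of_real ((A - B) / 4) * \<phi> 0"
    unfolding log_coeff_eq(1)[OF f] a_def[symmetric] a by simp
  then have 1: "norm (log_coeff f 1) = (A - B) / 4 * norm (\<phi> 0)"
    using \<open>B < A\<close> by (simp only: norm_mult norm_of_real) simp
  have "log_coeff f 2 =
      of_real ((A - B) / 12) * (deriv \<phi> 0 + of_real ((A - 5 * B) / 4) * (\<phi> 0)\<^sup>2)"
    unfolding log_coeff_eq(2)[OF f] a_def[symmetric] b_def[symmetric] a b
    by (simp add: field_simps power2_eq_square)
  then have 2: "norm (log_coeff f 2) =
      (A - B) / 12 * norm (deriv \<phi> 0 + of_real ((A - 5 * B) / 4) * (\<phi> 0)\<^sup>2)"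
    using \<open>B < A\<close> by (simp only: norm_mult norm_of_real) simp
  show ?thesis unfolding 1 2 by (simp add: field_simps)
qed

section \<open>The extremal problem on the unit interval\<close>

text \<open>
  For \<open>q \<ge> 0\<close>, the minimum over \<open>x \<in> [0, 1]\<close> of \<open>max 0 ((1 + q) x\<^sup>2 - 1) - 3 x\<close>.
\<close>

definition kinked_parabola_min :: "real \<Rightarrow> real" where
  "kinked_parabola_min q =
     (if q \<le> 1 / 2 then q - 3
      else if q \<ge> 5 / 4 then - 3 / sqrt (1 + q)
      else - 1 - 9 / (4 * (1 + q)))"

text \<open>
  In the middle range the parabola is bounded below by its vertex value. For \<open>q \<le> 1/2\<close> the vertex
  is at least 1, and for \<open>q \<ge> 5/4\<close> it is at most the kink \<open>1 / sqrt (1 + q)\<close>, so that the parabola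
  is already increasing from there on.
\<close>

lemma kinked_parabola_min_le:
  assumes q: "0 \<le> q" and x: "0 \<le> x" "x \<le> 1"
  shows "kinked_parabola_min q \<le> max 0 ((1 + q) * x\<^sup>2 - 1) - 3 * x"
proof -
  consider "q \<le> 1/2" | "1/2 < q" "q \<ge> 5/4" | "1/2 < q" "q < 5/4" by linarith
  then show ?thesis
  proof cases
    case 1
    \<comment> \<open>The difference to the value at 1 is \<open>(1 - x) (3 - (1 + q) (1 + x))\<close>.\<close>
    have "(1 + q) * (1 + x) \<le> 3/2 * 2"
      using 1 q x by (intro mult_mono) auto
    then have "0 \<le> (1 - x) * (3 - (1 + q) * (1 + x))"
      using x by (intro mult_nonneg_nonneg) auto
    also have "\<dots> = ((1 + q) * x\<^sup>2 - 1 - 3 * x) - (q - 3)"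
      by (simp add: algebra_simps power2_eq_square)
    finally show ?thesis using 1 by (simp add: kinked_parabola_min_def)
  next
    case 2
    define s where "s = sqrt (1 + q)"
    have s2: "s\<^sup>2 = 1 + q" using q by (simp add: s_def)
    have s: "s \<ge> 3/2"
      unfolding s_def using 2 by (intro real_le_rsqrt) (simp add: power2_eq_square)
    have "- 3 / s \<le> max 0 (s\<^sup>2 * x\<^sup>2 - 1) - 3 * x"
    proof (cases "s * x \<le> 1")
      case True
      then have "x \<le> 1 / s" using s by (simp add: field_simps)
      then show ?thesis by simp
    next
      case False
      \<comment> \<open>Here the difference to the value at the kink is \<open>(s x - 1) (s x + 1 - 3 / s)\<close>.\<close>
      have "3 / s \<le> 2" using s by (simp add: field_simps)
      with False have "0 \<le> (s * x - 1) * (s * x + 1 - 3 / s)"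
        by (intro mult_nonneg_nonneg) auto
      also have "\<dots> = s\<^sup>2 * x\<^sup>2 - 1 - 3 * x + 3 / s"
        using s by (simp add: field_simps power2_eq_square)
      finally show ?thesis by simp
    qed
    with 2 show ?thesis by (simp add: kinked_parabola_min_def s2 s_def)
  next
    case 3
    have "0 \<le> (2 * (1 + q) * x - 3)\<^sup>2 / (4 * (1 + q))" using q by simp
    also have "\<dots> = ((1 + q) * x\<^sup>2 - 1 - 3 * x) - (- 1 - 9 / (4 * (1 + q)))"
      using q by (simp add: field_simps power2_eq_square)
    finally show ?thesis using 3 by (simp add: kinked_parabola_min_def)
  qed
qed

lemma kinked_parabola_min_attained:
  assumes q: "0 \<le> q"
  obtains x where "0 \<le> x" "x \<le> 1" "\<bar>(1 + q) * x\<^sup>2 - 1\<bar> - 3 * x = kinked_parabola_min q"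
proof -
  consider "q \<le> 1/2" | "1/2 < q" "q \<ge> 5/4" | "1/2 < q" "q < 5/4" by linarith
  then show thesis
  proof cases
    case 1
    then show thesis using q by (intro that[of 1]) (auto simp: kinked_parabola_min_def)
  next
    case 2
    have "(1 + q) * (1 / sqrt (1 + q))\<^sup>2 = 1" using q by (simp add: power_divide)
    then show thesis using 2 q
      by (intro that[of "1 / sqrt (1 + q)"]) (auto simp: kinked_parabola_min_def)
  next
    case 3
    define x where "x = 3 / (2 * (1 + q))"
    have "r * (3 / (2 * r))\<^sup>2 = 9 / (4 * r)" if "r > 0" for r :: real
      using that by (simp add: power2_eq_square)
    from this[of "1 + q"] have e: "(1 + q) * x\<^sup>2 - 1 = 9 / (4 * (1 + q)) - 1"
      using q by (simp add: x_def)
    have "9 / (4 * (1 + q)) \<ge> 1" using 3 q by (simp add: field_simps)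
    then have "\<bar>(1 + q) * x\<^sup>2 - 1\<bar> = 9 / (4 * (1 + q)) - 1"
      unfolding e by simp
    moreover have "3 * x = 2 * (9 / (4 * (1 + q)))"
      using q by (simp add: x_def field_simps)
    ultimately have "\<bar>(1 + q) * x\<^sup>2 - 1\<bar> - 3 * x = kinked_parabola_min q"
      using 3 by (simp add: kinked_parabola_min_def)
    moreover have "0 \<le> x" "x \<le> 1" using 3 q by (auto simp: x_def field_simps)
    ultimately show thesis by (intro that)
  qed
qed

section \<open>Bounds and sharpness\<close>

text \<open>
  The triangle inequality, used in both directions, eliminates the arguments of \<open>c\<close> and \<open>d\<close> and
  reduces the problem to \<open>x = \<bar>c\<bar>\<close>. The quadratic terms never outweigh the linear one in the upper
  bound since \<open>(\<bar>\<mu>\<bar> - 1) x\<^sup>2 \<le> x\<^sup>2 / 2 \<le> 3 x\<close>.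
\<close>

lemma coefficient_functional_bounds:
  fixes c d :: complex and \<mu> :: real
  assumes d: "norm d \<le> 1 - (norm c)\<^sup>2" and \<mu>: "\<bar>\<mu>\<bar> \<le> 3 / 2"
  shows "norm (d + of_real \<mu> * c\<^sup>2) - 3 * norm c \<le> 1"
    and "kinked_parabola_min \<bar>\<mu>\<bar> \<le> norm (d + of_real \<mu> * c\<^sup>2) - 3 * norm c"
proof -
  define x where "x = norm c"
  have "x\<^sup>2 \<le> 1" using d norm_ge_zero[of d] unfolding x_def by linarith
  then have x: "0 \<le> x" "x \<le> 1" by (auto simp: x_def abs_square_le_1)
  have m: "norm (of_real \<mu> * c\<^sup>2) = \<bar>\<mu>\<bar> * x\<^sup>2"
    by (simp add: norm_mult norm_power x_def)
  have "norm (d + of_real \<mu> * c\<^sup>2) \<le> 1 - x\<^sup>2 + \<bar>\<mu>\<bar> * x\<^sup>2"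
    using norm_triangle_ineq[of d "of_real \<mu> * c\<^sup>2"] d m by (simp add: x_def)
  moreover have "\<bar>\<mu>\<bar> * x\<^sup>2 \<le> 3/2 * x\<^sup>2" using \<mu> by (intro mult_right_mono) auto
  moreover have "x\<^sup>2 \<le> x" using x by (simp add: power2_eq_square mult_left_le)
  ultimately show "norm (d + of_real \<mu> * c\<^sup>2) - 3 * norm c \<le> 1"
    using x by (simp add: x_def[symmetric])
  have "norm (of_real \<mu> * c\<^sup>2) - norm d \<le> norm (d + of_real \<mu> * c\<^sup>2)"
    using norm_diff_ineq[of "of_real \<mu> * c\<^sup>2" d] by (simp add: add.commute)
  then have "(1 + \<bar>\<mu>\<bar>) * x\<^sup>2 - 1 \<le> norm (d + of_real \<mu> * c\<^sup>2)"
    using d m by (simp add: x_def[symmetric] algebra_simps)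
  then have "max 0 ((1 + \<bar>\<mu>\<bar>) * x\<^sup>2 - 1) \<le> norm (d + of_real \<mu> * c\<^sup>2)" by simp
  with kinked_parabola_min_le[OF abs_ge_zero[of \<mu>] x]
  show "kinked_parabola_min \<bar>\<mu>\<bar> \<le> norm (d + of_real \<mu> * c\<^sup>2) - 3 * norm c"
    unfolding x_def[symmetric] by linarith
qed

text \<open>
  The functions \<open>\<phi>\<close> that give equality in the Schwarz--Pick inequality with a prescribed value at 0 and
  a prescribed sign of the derivative; at \<open>x = 1\<close> the quotient degenerates to the constant 1.
\<close>

lemma moebius_extremal:
  fixes x \<epsilon> :: real
  assumes x: "0 \<le> x" "x \<le> 1" and \<epsilon>: "\<bar>\<epsilon>\<bar> = 1"
  defines "\<phi> \<equiv> \<lambda>z::complex. (of_real x - of_real \<epsilon> * z) / (1 - of_real (\<epsilon> * x) * z)"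
  shows "\<phi> holomorphic_on unit_disc" and "norm z < 1 \<Longrightarrow> norm (\<phi> z) \<le> 1"
    and "deriv \<phi> 0 = - of_real (\<epsilon> * (1 - x\<^sup>2))"
proof -
  have nz: "1 - of_real (\<epsilon> * x) * w \<noteq> 0" if "norm w < 1" for w :: complex
    using one_plus_of_real_mult_nonzero[of "- (\<epsilon> * x)" w] that x \<epsilon> by (simp add: abs_mult)
  show "\<phi> holomorphic_on unit_disc"
    unfolding \<phi>_def using nz by (intro holomorphic_intros) auto
  show "norm (\<phi> z) \<le> 1" if z: "norm z < 1"
  proof -
    define w where "w = of_real \<epsilon> * z"
    have w: "norm w < 1" using z \<epsilon> by (simp add: w_def norm_mult)
    have "(norm (1 - of_real x * w))\<^sup>2 - (norm (of_real x - w))\<^sup>2 = (1 - x\<^sup>2) * (1 - (norm w)\<^sup>2)"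
      unfolding cmod_power2 by (simp add: algebra_simps power2_eq_square)
    also have "\<dots> \<ge> 0"
      using x w by (intro mult_nonneg_nonneg) (auto simp: power_le_one)
    finally have "norm (of_real x - w) \<le> norm (1 - of_real x * w)"
      by (intro power2_le_imp_le[OF _ norm_ge_zero]) simp
    then have "norm (of_real x - of_real \<epsilon> * z) \<le> norm (1 - of_real (\<epsilon> * x) * z)"
      by (simp add: w_def mult_ac)
    with nz[OF z] show ?thesis by (simp add: \<phi>_def norm_divide)
  qed
  have "(\<phi> has_field_derivative - of_real (\<epsilon> * (1 - x\<^sup>2))) (at 0)"
    unfolding \<phi>_def
    by (auto intro!: derivative_eq_intros simp: algebra_simps power2_eq_square)
  then show "deriv \<phi> 0 = - of_real (\<epsilon> * (1 - x\<^sup>2))" by (rule DERIV_imp_deriv)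
qed

lemma janowski_convex_extremal:
  fixes A B x :: real
  assumes B: "\<bar>B\<bar> \<le> 1" and AB: "B < A" and x: "0 \<le> x" "x \<le> 1"
  obtains f where "f \<in> janowski_convex A B"
    "norm (log_coeff f 2) - norm (log_coeff f 1) =
      (A - B) / 12 * (\<bar>(1 + \<bar>(A - 5 * B) / 4\<bar>) * x\<^sup>2 - 1\<bar> - 3 * x)"
proof -
  define \<mu> where "\<mu> = (A - 5 * B) / 4"
  \<comment> \<open>Not \<open>sgn \<mu>\<close>: for \<open>\<mu> = 0\<close> a unit is needed all the same.\<close>
  define \<epsilon> :: real where "\<epsilon> = (if \<mu> \<ge> 0 then 1 else - 1)"
  have \<epsilon>: "\<bar>\<epsilon>\<bar> = 1" "\<mu> = \<epsilon> * \<bar>\<mu>\<bar>" by (auto simp: \<epsilon>_def)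
  define \<phi> where "\<phi> = (\<lambda>z::complex. (of_real x - of_real \<epsilon> * z) / (1 - of_real (\<epsilon> * x) * z))"
  have \<phi>: "\<phi> holomorphic_on unit_disc" "\<And>z. norm z < 1 \<Longrightarrow> norm (\<phi> z) \<le> 1"
      "deriv \<phi> 0 = - of_real (\<epsilon> * (1 - x\<^sup>2))"
    unfolding \<phi>_def by (rule moebius_extremal[OF x \<epsilon>(1)]; assumption?)+
  have \<phi>0: "\<phi> 0 = of_real x" by (simp add: \<phi>_def)
  obtain f where f: "f \<in> janowski_convex A B"
    "\<And>z. z \<in> unit_disc \<Longrightarrow> z * deriv (deriv f) z * (1 + of_real B * (z * \<phi> z)) =
                      of_real (A - B) * (z * \<phi> z) * deriv f z"
    using janowski_ode_solvable[OF B \<phi>(1,2)] by metis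
  have "f \<in> class_A" using f(1) by (simp add: janowski_convex_def)
  note diff = norm_log_coeff_diff[OF AB this \<phi>(1) f(2), folded \<mu>_def]
  have "deriv \<phi> 0 + of_real \<mu> * (\<phi> 0)\<^sup>2 = of_real (\<mu> * x\<^sup>2 - \<epsilon> * (1 - x\<^sup>2))"
    unfolding \<phi>(3) \<phi>0 by simp
  also have "\<mu> * x\<^sup>2 - \<epsilon> * (1 - x\<^sup>2) = \<epsilon> * ((1 + \<bar>\<mu>\<bar>) * x\<^sup>2 - 1)"
    by (subst \<epsilon>(2)) (simp add: algebra_simps)
  finally have "norm (deriv \<phi> 0 + of_real \<mu> * (\<phi> 0)\<^sup>2) = \<bar>(1 + \<bar>\<mu>\<bar>) * x\<^sup>2 - 1\<bar>"
    using \<epsilon>(1) by (simp only: norm_of_real abs_mult) simp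
  with diff f(1) x show thesis
    by (intro that[of f]) (auto simp: \<mu>_def \<phi>0)
qed

theorem theorem4p1:
  fixes A B :: real
  assumes "- 1 \<le> B" and "B < A" and "A \<le> 1"
  shows "let L = (if \<bar>A - 5 * B\<bar> \<le> 2 then - ((A - B) / 4) * (1 - \<bar>A - 5 * B\<bar> / 12)
                  else if \<bar>A - 5 * B\<bar> \<ge> 5 then - ((A - B) / 2) * (1 / sqrt (\<bar>A - 5 * B\<bar> + 4))
                  else - ((A - B) / 12) * (1 + 9 / (\<bar>A - 5 * B\<bar> + 4)))
     in (\<forall>f \<in> janowski_convex A B.
           norm (log_coeff f 2) - norm (log_coeff f 1) \<le> (A - B) / 12 \<and>
           norm (log_coeff f 2) - norm (log_coeff f 1) \<ge> L)
      \<and> (\<exists>f \<in> janowski_convex A B.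
           norm (log_coeff f 2) - norm (log_coeff f 1) = (A - B) / 12)
      \<and> (\<exists>f \<in> janowski_convex A B.
           norm (log_coeff f 2) - norm (log_coeff f 1) = L)"
proof -
  define \<mu> where "\<mu> = (A - 5 * B) / 4"
  have B: "\<bar>B\<bar> \<le> 1" and \<mu>: "\<bar>\<mu>\<bar> \<le> 3 / 2"
    using assms by (auto simp: \<mu>_def)
  define L where "L = (if \<bar>A - 5 * B\<bar> \<le> 2 then - ((A - B) / 4) * (1 - \<bar>A - 5 * B\<bar> / 12)
      else if \<bar>A - 5 * B\<bar> \<ge> 5 then - ((A - B) / 2) * (1 / sqrt (\<bar>A - 5 * B\<bar> + 4))
      else - ((A - B) / 12) * (1 + 9 / (\<bar>A - 5 * B\<bar> + 4)))"
  have L: "L = (A - B) / 12 * kinked_parabola_min \<bar>\<mu>\<bar>"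
  proof -
    define s where "s = \<bar>A - 5 * B\<bar>"
    have s: "\<bar>\<mu>\<bar> = s / 4" by (auto simp: \<mu>_def s_def)
    have "1 + s / 4 = (s + 4) / 4" by simp
    then have "sqrt (1 + s / 4) = sqrt (s + 4) / 2"
      by (simp only: real_sqrt_divide real_sqrt_four)
    then have root: "3 / sqrt (1 + s / 4) = 6 / sqrt (s + 4)"
      by (simp only: divide_divide_eq_right)
    have four: "4 * (1 + s / 4) = s + 4" by simp
    define r where "r = s + 4"
    show ?thesis
      using root unfolding L_def kinked_parabola_min_def s s_def[symmetric] four r_def[symmetric]
      by (auto simp: algebra_simps diff_divide_distrib)
  qed
  have bounds: "norm (log_coeff f 2) - norm (log_coeff f 1) \<le> (A - B) / 12 \<and>
      norm (log_coeff f 2) - norm (log_coeff f 1) \<ge> L" if mem: "f \<in> janowski_convex A B" for f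
  proof -
    obtain \<phi> where f: "f \<in> class_A" and \<phi>: "\<phi> holomorphic_on unit_disc"
        "\<forall>z\<in>unit_disc. norm (\<phi> z) \<le> 1"
        "\<forall>z\<in>unit_disc. z * deriv (deriv f) z * (1 + of_real B * (z * \<phi> z)) =
                      of_real (A - B) * (z * \<phi> z) * deriv f z"
      using mem unfolding janowski_convex_iff[OF B] by blast
    have "norm (deriv \<phi> 0) \<le> 1 - (norm (\<phi> 0))\<^sup>2"
      using \<phi>(2) by (intro Schwarz_Pick_origin[OF \<phi>(1)]) simp
    note bounds = coefficient_functional_bounds[OF this \<mu>]
    let ?J = "norm (deriv \<phi> 0 + of_real \<mu> * (\<phi> 0)\<^sup>2) - 3 * norm (\<phi> 0)"
    have diff: "norm (log_coeff f 2) - norm (log_coeff f 1) = (A - B) / 12 * ?J"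
      unfolding \<mu>_def using \<phi> by (intro norm_log_coeff_diff[OF \<open>B < A\<close> f]) auto
    have "(A - B) / 12 * ?J \<le> (A - B) / 12 * 1"
      using bounds(1) \<open>B < A\<close> by (intro mult_left_mono) auto
    moreover have "L \<le> (A - B) / 12 * ?J"
      unfolding L using bounds(2) \<open>B < A\<close> by (intro mult_left_mono) auto
    ultimately show ?thesis unfolding diff by simp
  qed
  have upper: "\<exists>f \<in> janowski_convex A B.
      norm (log_coeff f 2) - norm (log_coeff f 1) = (A - B) / 12"
    using janowski_convex_extremal[OF B \<open>B < A\<close>, of 0] by force
  obtain x where x: "0 \<le> x" "x \<le> 1" "\<bar>(1 + \<bar>\<mu>\<bar>) * x\<^sup>2 - 1\<bar> - 3 * x = kinked_parabola_min \<bar>\<mu>\<bar>"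
    using kinked_parabola_min_attained[of "\<bar>\<mu>\<bar>"] by auto
  have lower: "\<exists>f \<in> janowski_convex A B. norm (log_coeff f 2) - norm (log_coeff f 1) = L"
    using janowski_convex_extremal[OF B \<open>B < A\<close> x(1,2), folded \<mu>_def, unfolded x(3)]
    unfolding L by metis
  show ?thesis
    unfolding Let_def L_def[symmetric] using bounds upper lower by blast
qed

end
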